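(* Let $\Sigma$ be a finite nonempty alphabet and let the non-empty feasible set $\mathcal{X}(u)\subseteq\Sigma^{\le T}$ be encoded by a deterministic finite automaton $(Q,\Sigma,\delta,q_0,F)$ with sink state $q_{\bot}$. Then any sequence $x$ generated by the masked autoregressive decoder described in the context (for any choice of the logits) satisfies $x\in\mathcal{X}(u)$.
   Context: DFA. A deterministic finite automaton (DFA) is a tuple $(Q,\Sigma,\delta,q_0,F)$ with $Q$ a finite nonempty set of states, $\Sigma$ a finite nonempty alphabet (labels), $\delta:Q\times\Sigma\to Q$ a (total) transition function, $q_0\in Q$ the starting state, and $F\subseteq Q$ the set of accepting states. A string $(\sigma_1,\dots,\sigma_k)$ is accepted if, with $q_{i+1}=\delta(q_i,\sigma_{i+1})$ for $0\le i\le k-1$, one has $q_k\in F$. The DFA encodes $\mathcal{X}(u)$ if the set of accepted strings equals $\mathcal{X}(u)$; here $\mathcal{X}(u)\subseteq\Sigma^{\le T}$, the set of sequences over $\Sigma$ of length at most $T$. Sink state. $Q$ contains a unique non-accepting sink state $q_{\bot}\notin F$ with $\delta(q_{\bot},\sigma)=q_{\bot}$ for all $\sigma$, and $q_{\bot}$ is the only state from which no accepting state can be reached (by a path of zero or more transitions). Mask. For $q\in Q$, $m(q):=\{\sigma\in\Sigma:\delta(q,\sigma)\in Q\setminus\{q_{\bot}\}\}$. Masked autoregressive decoder. For a given instance $u$ and every prefix $x_{<t}=(x_1,\dots,x_{t-1})$, a model with parameters $\phi$ produces real-valued scores (logits) $L_t\in\mathbb{R}^{\Sigma}$. The decoder starts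 with the empty prefix in state $q_0$. At step $t\ge1$, in state $q_{t-1}$, the logits of all labels outside $m(q_{t-1})$ are replaced by $-\infty$ and a softmax is applied, giving a distribution $p_{\phi}(\cdot\mid u,x_{<t})$ on $\Sigma$ which is zero exactly on the labels outside $m(q_{t-1})$. A label $x_t$ is then selected from $m(q_{t-1})$, either by sampling from this distribution or greedily (a label of maximum probability), it is appended to the prefix, and the state is updated to $q_t=\delta(q_{t-1},x_t)$. As in random sampling from the DFA, generation can stop only when the current state is in $F$ (it must stop there if the mask is empty, and otherwise may stop or continue); the generated sequence is the prefix $x=(x_1,\dots,x_k)$ at the moment of stopping. *)

theory Defs
  imports "HOL-Library.Extended_Real"
begin

record ('s, 'a) dfa =
  states :: "'s set"
  alphabet :: "'a set"
  trans :: "'s \<Rightarrow> 'a \<Rightarrow> 's"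
  start :: "'s"
  accepting :: "'s set"

text \<open>The transition function only matters on \<open>states A \<times> alphabet A\<close>, which it must map into
  \<open>states A\<close>.\<close>

definition is_dfa :: "('s, 'a) dfa \<Rightarrow> bool" where
  "is_dfa A \<longleftrightarrow>
     finite (states A) \<and> states A \<noteq> {} \<and>
     finite (alphabet A) \<and> alphabet A \<noteq> {} \<and>
     (\<forall>q \<in> states A. \<forall>\<sigma> \<in> alphabet A. trans A q \<sigma> \<in> states A) \<and>
     start A \<in> states A \<and>
     accepting A \<subseteq> states A"

definition run :: "('s, 'a) dfa \<Rightarrow> 's \<Rightarrow> 'a list \<Rightarrow> 's" where
  "run A q w = foldl (trans A) q w"

definition language :: "('s, 'a) dfa \<Rightarrow> 'a list set" where
  "language A = {w \<in> lists (alphabet A). run A (start A) w \<in> accepting A}"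

definition encodes :: "('s, 'a) dfa \<Rightarrow> 'a list set \<Rightarrow> bool" where
  "encodes A X \<longleftrightarrow> language A = X"

definition nonaccepting_sink :: "('s, 'a) dfa \<Rightarrow> 's \<Rightarrow> bool" where
  "nonaccepting_sink A q \<longleftrightarrow>
     q \<in> states A \<and> q \<notin> accepting A \<and> (\<forall>\<sigma> \<in> alphabet A. trans A q \<sigma> = q)"

definition can_reach_accepting :: "('s, 'a) dfa \<Rightarrow> 's \<Rightarrow> bool" where
  "can_reach_accepting A q \<longleftrightarrow> (\<exists>w \<in> lists (alphabet A). run A q w \<in> accepting A)"

definition is_sink_state :: "('s, 'a) dfa \<Rightarrow> 's \<Rightarrow> bool" where
  "is_sink_state A qbot \<longleftrightarrow>
     (\<forall>q. nonaccepting_sink A q \<longleftrightarrow> q = qbot) \<and>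
     (\<forall>q \<in> states A. \<not> can_reach_accepting A q \<longleftrightarrow> q = qbot)"

definition mask :: "('s, 'a) dfa \<Rightarrow> 's \<Rightarrow> 's \<Rightarrow> 'a set" where
  "mask A qbot q = {\<sigma> \<in> alphabet A. trans A q \<sigma> \<in> states A - {qbot}}"

text \<open>Masked logits take values in \<open>\<real> \<union> {-\<infinity>}\<close>; the exponential is extended by \<open>exp (-\<infinity>) = 0\<close>.
  The value \<open>\<infinity>\<close> never occurs as a masked logit.\<close>

definition exp_score :: "ereal \<Rightarrow> real" where
  "exp_score z = (if z = -\<infinity> then 0 else exp (real_of_ereal z))"

definition softmax :: "'a set \<Rightarrow> ('a \<Rightarrow> ereal) \<Rightarrow> 'a \<Rightarrow> real" where
  "softmax S z \<sigma> = exp_score (z \<sigma>) / (\<Sum>\<tau> \<in> S. exp_score (z \<tau>))"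

definition masked_logits :: "'a set \<Rightarrow> ('a \<Rightarrow> real) \<Rightarrow> 'a \<Rightarrow> ereal" where
  "masked_logits M l \<sigma> = (if \<sigma> \<in> M then ereal (l \<sigma>) else -\<infinity>)"

definition next_label_prob ::
  "('s, 'a) dfa \<Rightarrow> 's \<Rightarrow> ('a \<Rightarrow> real) \<Rightarrow> 's \<Rightarrow> 'a \<Rightarrow> real" where
  "next_label_prob A qbot l q = softmax (alphabet A) (masked_logits (mask A qbot q) l)"

text \<open>The possible outcomes of sampling from a distribution \<open>p\<close> on the finite set \<open>S\<close> are the labels
  of positive probability.\<close>

definition sampled_label :: "'a set \<Rightarrow> ('a \<Rightarrow> real) \<Rightarrow> 'a \<Rightarrow> bool" where
  "sampled_label S p \<sigma> \<longleftrightarrow> \<sigma> \<in> S \<and> p \<sigma> > 0"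

definition greedy_label :: "'a set \<Rightarrow> ('a \<Rightarrow> real) \<Rightarrow> 'a \<Rightarrow> bool" where
  "greedy_label S p \<sigma> \<longleftrightarrow> \<sigma> \<in> S \<and> (\<forall>\<tau> \<in> S. p \<tau> \<le> p \<sigma>)"

text \<open>\<open>decoder_at A qbot L x q\<close>: the decoder can get to prefix \<open>x\<close> with current state \<open>q\<close>, where
  \<open>L x\<close> is the logit vector produced after prefix \<open>x\<close> (the step index is \<open>length x + 1\<close>).
  A step needs a nonempty mask: otherwise the softmax is undefined (\<open>0 / 0\<close>) and the decoder
  cannot continue. With a nonempty mask, the labels outside it have probability \<open>0\<close> and those in
  it have positive probability, so both selection rules return a label in the mask.
  The selection rule may be chosen anew at each step, which covers pure sampling and pure greedy
  decoding.\<close>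

inductive decoder_at ::
  "('s, 'a) dfa \<Rightarrow> 's \<Rightarrow> ('a list \<Rightarrow> 'a \<Rightarrow> real) \<Rightarrow> 'a list \<Rightarrow> 's \<Rightarrow> bool"
  for A :: "('s, 'a) dfa" and qbot :: 's and L :: "'a list \<Rightarrow> 'a \<Rightarrow> real"
where
  init: "decoder_at A qbot L [] (start A)"
| step: "decoder_at A qbot L x q \<Longrightarrow>
         mask A qbot q \<noteq> {} \<Longrightarrow>
         sampled_label (alphabet A) (next_label_prob A qbot (L x) q) \<sigma> \<or>
           greedy_label (alphabet A) (next_label_prob A qbot (L x) q) \<sigma> \<Longrightarrow>
         decoder_at A qbot L (x @ [\<sigma>]) (trans A q \<sigma>)"

text \<open>Stopping is possible exactly in accepting states. At an accepting state with empty mask it is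
  forced, since \<open>decoder_at\<close> has no further step; with nonempty mask the decoder may stop or
  continue.\<close>

definition generated ::
  "('s, 'a) dfa \<Rightarrow> 's \<Rightarrow> ('a list \<Rightarrow> 'a \<Rightarrow> real) \<Rightarrow> 'a list \<Rightarrow> bool" where
  "generated A qbot L x \<longleftrightarrow> (\<exists>q. decoder_at A qbot L x q \<and> q \<in> accepting A)"

end

theory Submission
  imports Defs
begin

text \<open>The decoder's state is the state the automaton reaches on the prefix, and decoding stops only in
  accepting states. Soundness thus depends only on the stopping rule; the mask merely keeps the decoder
  out of states from which it could never stop.\<close>

text \<open>The first conjunct is carried along because \<open>language\<close> only admits words
  over the alphabet.\<close>

lemma decoder_at_run:
  assumes "decoder_at A qbot L x q"
  shows "x \<in> lists (alphabet A) \<and> q = run A (start A) x"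
  using assms
  \<comment> \<open>Both selection rules contain membership in the alphabet, and
    \<open>foldl\<close> on \<open>x @ [\<sigma>]\<close> ends with exactly the decoder's update
    \<open>trans A q \<sigma>\<close>.\<close>
  by induction (auto simp: run_def sampled_label_def greedy_label_def)

lemma generated_in_language:
  assumes "generated A qbot L x"
  shows "x \<in> language A"
  using assms decoder_at_run unfolding generated_def language_def by fastforce

theorem proposition3p3:
  fixes X :: "'u \<Rightarrow> 'a list set"
    and u :: 'u
    and T :: nat
    and A :: "('s, 'a) dfa"
    and qbot :: 's
    and logits :: "'p \<Rightarrow> 'u \<Rightarrow> 'a list \<Rightarrow> 'a \<Rightarrow> real"
    and \<phi> :: 'p
    and x :: "'a list"
  assumes "is_dfa A"
    and "is_sink_state A qbot"
    and "X u \<noteq> {}"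
    and "X u \<subseteq> {w \<in> lists (alphabet A). length w \<le> T}"
    and "encodes A (X u)"
    and "generated A qbot (logits \<phi> u) x"
  shows "x \<in> X u"
  \<comment> \<open>The lemma covers every logit function \<open>L\<close>; here \<open>L\<close> is
    \<open>logits \<phi> u\<close>.\<close>
  using generated_in_language assms unfolding encodes_def by metis

end
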